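(* Let $L_1$ and $L_2$ be two Legendrian submanifolds of $J^1(\mathbb{R}^n,\mathbb{R})$. Then their sum $L_1 \underline{+} L_2$ and their convolution $L_1 \underline{\square} L_2$ are linked by the following identities of subsets of $J^1(\mathbb{R}^n,\mathbb{R})$: (i) $\mathbf{T}(L_1 \underline{+} L_2) = (\mathbf{T}L_1)\,\underline{\square}\,(\mathbf{T}L_2)$, and (ii) $\mathbf{T}(L_1 \underline{\square} L_2) = (\mathbf{T}L_1)\,\underline{+}\,(\mathbf{T}L_2)$.
   Context: $J^1(\mathbb{R}^n,\mathbb{R})=\mathbb{R}\times\mathbb{R}^n\times\mathbb{R}^n$ has coordinates $(u,q,p)$ and is endowed with the contact structure $\ker(du-p\,dq)$, where $p\,dq=\sum_{i=1}^n p_i\,dq_i$. All objects are smooth. A Legendrian submanifold is an $n$-dimensional submanifold $L$ of $J^1(\mathbb{R}^n,\mathbb{R})$ on which $du-p\,dq$ vanishes identically. For subsets $L_1,L_2\subset J^1(\mathbb{R}^n,\mathbb{R})$ (in particular for Legendrian submanifolds), the sum is $$L_1\underline{+}L_2=\{(u_1+u_2,q,p_1+p_2)\mid (u_i,q,p_i)\in L_i,\ i\in\{1,2\}\},$$ and the convolution is $$L_1\underline{\square}L_2=\{(u_1+u_2,q_1+q_2,p)\mid (u_i,q_i,p)\in L_i,\ i\in\{1,2\}\}.$$ The transformation $\mathbf{T}:J^1(\mathbb{R}^n,\mathbb{R})\to J^1(\mathbb{R}^n,\mathbb{R})$ is $\mathbf{T}(u,q,p)=(qp-u,p,q)$, where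 $qp$ is the Euclidean scalar product; $\mathbf{T}L$ denotes the image of $L$. *)

theory Defs
  imports "HOL-Analysis.Analysis"
begin

text \<open>
  C^k and C^infinity maps on an open subset of a Euclidean space. In finite dimension,
  f is C^(k+1) on an open set iff f is differentiable there and all directional derivatives
  x |-> df(x)v are C^k.  The definition is meant for open sets only: the derivative is the full one.
\<close>

primrec Ck_on :: "nat \<Rightarrow> 'a set \<Rightarrow> ('a::euclidean_space \<Rightarrow> 'b::euclidean_space) \<Rightarrow> bool" where
  "Ck_on 0 U f \<longleftrightarrow> continuous_on U f"
| "Ck_on (Suc k) U f \<longleftrightarrow>
     (\<forall>x\<in>U. f differentiable (at x)) \<and> (\<forall>v. Ck_on k U (\<lambda>x. frechet_derivative f (at x) v))"

definition smooth_on :: "'a set \<Rightarrow> ('a::euclidean_space \<Rightarrow> 'b::euclidean_space) \<Rightarrow> bool" where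
  "smooth_on U f \<longleftrightarrow> open U \<and> (\<forall>k. Ck_on k U f)"

definition diffeomorphism :: "'a set \<Rightarrow> 'b set \<Rightarrow> ('a::euclidean_space \<Rightarrow> 'b::euclidean_space) \<Rightarrow> ('b \<Rightarrow> 'a) \<Rightarrow> bool" where
  "diffeomorphism U V \<phi> \<psi> \<longleftrightarrow> homeomorphism U V \<phi> \<psi> \<and> smooth_on U \<phi> \<and> smooth_on V \<psi>"

text \<open>
  Embedded smooth submanifolds of dimension d, via slice charts: near each of its points, M is
  carried by an ambient diffeomorphism to a linear subspace of dimension d.
\<close>

definition submanifold :: "nat \<Rightarrow> 'a::euclidean_space set \<Rightarrow> bool" where
  "submanifold d M \<longleftrightarrow>
     (\<forall>x\<in>M. \<exists>U V \<phi> \<psi> (S :: 'a set). x \<in> U \<and> diffeomorphism U V \<phi> \<psi> \<and>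
        subspace S \<and> dim S = d \<and> \<phi> ` (M \<inter> U) = S \<inter> V)"

text \<open>Tangent vectors are the velocities of smooth curves lying in the submanifold.\<close>

definition tangent_space :: "'a::euclidean_space set \<Rightarrow> 'a \<Rightarrow> 'a set" where
  "tangent_space M x =
     {v. \<exists>\<epsilon>>0. \<exists>c :: real \<Rightarrow> 'a. smooth_on {-\<epsilon><..<\<epsilon>} c \<and> c ` {-\<epsilon><..<\<epsilon>} \<subseteq> M \<and>
           c 0 = x \<and> (c has_vector_derivative v) (at 0)}"

text \<open>
  The jet space J^1(R^n,R), with coordinates (u,q,p); tangent vectors to it are written
  (du,dq,dp) in the same type.
\<close>

type_synonym 'n jet = "real \<times> (real ^ 'n) \<times> (real ^ 'n)"

fun contact_form :: "'n::finite jet \<Rightarrow> 'n jet \<Rightarrow> real" where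
  "contact_form (u, q, p) (du, dq, dp) = du - (\<Sum>i\<in>UNIV. p $ i * dq $ i)"

definition legendrian :: "'n::finite jet set \<Rightarrow> bool" where
  "legendrian L \<longleftrightarrow> submanifold CARD('n) L \<and>
     (\<forall>x\<in>L. \<forall>v\<in>tangent_space L x. contact_form x v = 0)"

definition jet_sum :: "'n::finite jet set \<Rightarrow> 'n jet set \<Rightarrow> 'n jet set" where
  "jet_sum L1 L2 = {(u1 + u2, q, p1 + p2) | u1 u2 q p1 p2. (u1, q, p1) \<in> L1 \<and> (u2, q, p2) \<in> L2}"

definition jet_convolution :: "'n::finite jet set \<Rightarrow> 'n jet set \<Rightarrow> 'n jet set" where
  "jet_convolution L1 L2 =
     {(u1 + u2, q1 + q2, p) | u1 u2 q1 q2 p. (u1, q1, p) \<in> L1 \<and> (u2, q2, p) \<in> L2}"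

fun jet_T :: "'n::finite jet \<Rightarrow> 'n jet" where
  "jet_T (u, q, p) = (q \<bullet> p - u, p, q)"

end

theory Submission
  imports Defs
begin

text \<open>
  The Legendre-type map \<^const>\<open>jet_T\<close> exchanges the base coordinate \<open>q\<close> and the fibre
  coordinate \<open>p\<close>.  The sum matches points over a common \<open>q\<close> and adds their \<open>p\<close>; the
  convolution matches points over a common \<open>p\<close> and adds their \<open>q\<close>.  So the map must
  exchange the two operations, provided the first coordinate \<open>q \<bullet> p - u\<close> is compatible with
  them; it is, because \<open>q \<bullet> p\<close> is additive in either variable when the other one is the
  shared one: \<open>(q1 + q2) \<bullet> p - (u1 + u2) = (q1 \<bullet> p - u1) + (q2 \<bullet> p - u2)\<close>.

  This computation gives the identity for the convolution.  The map is an involution, so the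
  identity for the sum follows by applying that one to the transformed sets.
\<close>

lemma jet_T_involution: "jet_T (jet_T x) = x"
  by (cases x) (simp add: inner_commute)

lemma jet_T_image_involution: "jet_T ` jet_T ` L = L"
  by (simp add: image_image jet_T_involution)

lemma mem_jet_T_image_iff: "x \<in> jet_T ` L \<longleftrightarrow> jet_T x \<in> L"
proof
  assume "x \<in> jet_T ` L"
  then show "jet_T x \<in> L"
    by (elim imageE) (simp only: jet_T_involution)
next
  assume "jet_T x \<in> L"
  then have "jet_T (jet_T x) \<in> jet_T ` L"
    by (rule imageI)
  then show "x \<in> jet_T ` L"
    by (simp only: jet_T_involution)
qed

lemma jet_T_image_convolution:
  "jet_T ` jet_convolution L1 L2 = jet_sum (jet_T ` L1) (jet_T ` L2)"
proof (intro equalityI subsetI)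
  fix x assume "x \<in> jet_T ` jet_convolution L1 L2"
  then obtain u1 u2 q1 q2 p where L: "(u1, q1, p) \<in> L1" "(u2, q2, p) \<in> L2"
    and x: "x = jet_T (u1 + u2, q1 + q2, p)"
    by (auto simp: jet_convolution_def)
  have "x = ((q1 \<bullet> p - u1) + (q2 \<bullet> p - u2), p, q1 + q2)"
    by (simp add: x inner_add_left)
  moreover have "(q1 \<bullet> p - u1, p, q1) \<in> jet_T ` L1" "(q2 \<bullet> p - u2, p, q2) \<in> jet_T ` L2"
    using L by (simp_all add: mem_jet_T_image_iff inner_commute)
  ultimately show "x \<in> jet_sum (jet_T ` L1) (jet_T ` L2)"
    unfolding jet_sum_def by blast
next
  fix x assume "x \<in> jet_sum (jet_T ` L1) (jet_T ` L2)"
  then obtain u1 u2 q p1 p2 where x: "x = (u1 + u2, q, p1 + p2)"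
    and "(u1, q, p1) \<in> jet_T ` L1" "(u2, q, p2) \<in> jet_T ` L2"
    unfolding jet_sum_def by blast
  then have "(q \<bullet> p1 - u1, p1, q) \<in> L1" "(q \<bullet> p2 - u2, p2, q) \<in> L2"
    by (simp_all add: mem_jet_T_image_iff)
  moreover have "jet_T x = ((q \<bullet> p1 - u1) + (q \<bullet> p2 - u2), p1 + p2, q)"
    by (simp add: x inner_add_right)
  ultimately show "x \<in> jet_T ` jet_convolution L1 L2"
    unfolding mem_jet_T_image_iff jet_convolution_def by blast
qed

lemma jet_T_image_sum:
  "jet_T ` jet_sum L1 L2 = jet_convolution (jet_T ` L1) (jet_T ` L2)"
proof -
  have "jet_T ` jet_convolution (jet_T ` L1) (jet_T ` L2) = jet_sum L1 L2"
    by (simp add: jet_T_image_convolution jet_T_image_involution)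
  from arg_cong[OF this, of "image jet_T"] show ?thesis
    by (simp add: jet_T_image_involution)
qed

theorem theorem0p1:
  fixes L1 L2 :: "'n::finite jet set"
  assumes "legendrian L1" and "legendrian L2"
  shows "jet_T ` (jet_sum L1 L2) = jet_convolution (jet_T ` L1) (jet_T ` L2) \<and>
         jet_T ` (jet_convolution L1 L2) = jet_sum (jet_T ` L1) (jet_T ` L2)"
  by (simp add: jet_T_image_sum jet_T_image_convolution)

end
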